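(* Let $P$ be a finite poset on ground set $I$. Then the antipode of $J(P)$ is given by the cancellation-free (and grouping-free) formula $$\mathrm{S}(J(P),I)=\sum_{Q\in\mathrm{Good}(P)}(-1)^{c(Q)+|P\setminus Q|}\,(J(Q),I),$$ where $c(Q)$ is the number of components of $Q$; the set families $(J(Q),I)$, $Q\in\mathrm{Good}(P)$, are pairwise distinct.
   Context: A grounded set family on $I$ is $(\mathcal{F},I)$ with $\emptyset\in\mathcal{F}\subseteq 2^I$; the join of families on disjoint ground sets is $\mathcal{F}_1*\mathcal{F}_2=\{X\cup Y:X\in\mathcal{F}_1,Y\in\mathcal{F}_2\}$. For a set composition $\Phi=\Phi_1|\cdots|\Phi_m\models I$ (ordered partition into nonempty blocks, $|\Phi|=m$), let $\mathcal{F}_i=\{A\cap\Phi_i:A\in\mathcal{F},\ A\cap\Phi_j=\emptyset\ \forall j<i\}$ and $\mu_\Phi\Delta_\Phi(\mathcal{F},I)=(\mathcal{F}_1*\cdots*\mathcal{F}_m,I)$. The antipode (in the Hopf monoid of lattices of order ideals, a submonoid of the Hopf monoid of grounded set families with join product, restriction $\mathcal{F}|_S=\{F\cap S\}$ and contraction $\mathcal{F}/_S=\{F:F\cap S=\emptyset\}$) is the linear map on the vector space with basis the grounded set families on $I$ given by $\mathrm{S}(\mathcal{F},I)=\sum_{\Phi\models I}(-1)^{|\Phi|}\mu_\Phi\Delta_\Phi(\mathcal{F},I)$. $J(P)$ is the family of order ideals of $P$. A fracturing of $P$ is a poset $Q$ on a subset of $P$ that is a disjoint union of induced subposets of $P$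 ($x<_Qy$ iff same summand and $x<_Py$); its components are the connected components of its Hasse diagram. $Q$ is good if there is $\Phi\models I$ with $\mu_\Phi\Delta_\Phi(J(P),I)=(J(Q),I)$; $\mathrm{Good}(P)$ is the set of good fracturings of $P$. *)

theory Defs
  imports "HOL-Library.Poly_Mapping" "HOL-Library.Disjoint_Sets"
begin

text \<open>
  A grounded set family on a finite ground set \<open>I\<close> is written as the pair \<open>(F, I)\<close>.  A poset is
  given by its reflexive order relation \<open>r\<close>, and its ground set is \<open>Field r\<close>; reflexivity ensures
  that no point is lost, so \<open>{}\<close> is the empty poset.
\<close>

definition grounded_set_family :: "'a set set \<times> 'a set \<Rightarrow> bool" where
  "grounded_set_family S \<longleftrightarrow> {} \<in> fst S \<and> fst S \<subseteq> Pow (snd S)"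


subsection \<open>Set compositions and the antipode\<close>

definition join :: "'a set set \<Rightarrow> 'a set set \<Rightarrow> 'a set set" where
  "join F G = {X \<union> Y | X Y. X \<in> F \<and> Y \<in> G}"

definition set_compositions :: "'a set \<Rightarrow> 'a set list set" where
  "set_compositions I = {\<Phi>. distinct \<Phi> \<and> partition_on I (set \<Phi>)}"

definition minor :: "'a set list \<Rightarrow> 'a set set \<Rightarrow> nat \<Rightarrow> 'a set set" where
  "minor \<Phi> F i = {A \<inter> \<Phi> ! i | A. A \<in> F \<and> (\<forall>j<i. A \<inter> \<Phi> ! j = {})}"

text \<open>
  The unit \<open>{{}}\<close> of the join is the value at the empty composition, which is the only set
  composition of the empty ground set.
\<close>

definition mu_Delta :: "'a set list \<Rightarrow> 'a set set \<times> 'a set \<Rightarrow> 'a set set \<times> 'a set" where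
  "mu_Delta \<Phi> S = (foldr join (map (minor \<Phi> (fst S)) [0..<length \<Phi>]) {{}}, snd S)"

definition antipode_basis ::
    "'a set set \<times> 'a set \<Rightarrow> ('a set set \<times> 'a set) \<Rightarrow>\<^sub>0 'k::field" where
  "antipode_basis S =
     (\<Sum>\<Phi>\<in>set_compositions (snd S). Poly_Mapping.single (mu_Delta \<Phi> S) ((-1) ^ length \<Phi>))"

text \<open>
  The linear extension.  Elements of \<open>('a set set \<times> 'a set) \<Rightarrow>\<^sub>0 'k\<close> are the formal finite linear
  combinations over the field \<open>'k\<close>; the space with basis the grounded set families on \<open>I\<close> consists
  of those supported on grounded pairs \<open>(F, I)\<close>, and is mapped to itself.
\<close>

definition antipode ::
    "(('a set set \<times> 'a set) \<Rightarrow>\<^sub>0 'k::field) \<Rightarrow> (('a set set \<times> 'a set) \<Rightarrow>\<^sub>0 'k)" where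
  "antipode v =
     (\<Sum>S\<in>Poly_Mapping.keys v.
        Poly_Mapping.map ((*) (Poly_Mapping.lookup v S)) (antipode_basis S))"


subsection \<open>Order ideals and fracturings\<close>

definition order_ideals :: "'a rel \<Rightarrow> 'a set set" where
  "order_ideals r = {A. A \<subseteq> Field r \<and> (\<forall>x y. y \<in> A \<and> (x, y) \<in> r \<longrightarrow> x \<in> A)}"

text \<open>
  The classes of \<open>\<pi>\<close> are the ground sets of the summands.  A fracturing is the resulting poset
  only: it does not remember the decomposition into summands.
\<close>

definition fracturing :: "'a rel \<Rightarrow> 'a rel \<Rightarrow> bool" where
  "fracturing P Q \<longleftrightarrow>
     (\<exists>C \<pi>. C \<subseteq> Field P \<and> partition_on C \<pi> \<and>
            Q = {(x, y). \<exists>B\<in>\<pi>. x \<in> B \<and> y \<in> B \<and> (x, y) \<in> P})"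

definition hasse_diagram :: "'a rel \<Rightarrow> 'a rel" where
  "hasse_diagram r =
     {(x, y). (x, y) \<in> r \<and> x \<noteq> y \<and>
              \<not> (\<exists>z. z \<noteq> x \<and> z \<noteq> y \<and> (x, z) \<in> r \<and> (z, y) \<in> r)}"

definition components :: "'a rel \<Rightarrow> 'a set set" where
  "components r = Field r // (hasse_diagram r \<union> (hasse_diagram r)\<inverse>)\<^sup>*"

definition Good :: "'a rel \<Rightarrow> 'a rel set" where
  "Good P =
     {Q. fracturing P Q \<and>
         (\<exists>\<Phi>\<in>set_compositions (Field P).
            mu_Delta \<Phi> (order_ideals P, Field P) = (order_ideals Q, Field P))}"


subsection \<open>Basic well-formedness\<close>

lemma finite_set_compositions:
  assumes "finite I"
  shows "finite (set_compositions I)"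
proof (rule finite_subset)
  show "set_compositions I \<subseteq> {xs. set xs \<subseteq> Pow I \<and> distinct xs}"
    by (auto simp: set_compositions_def partition_on_def)
  show "finite {xs. set xs \<subseteq> Pow I \<and> distinct xs}"
    by (rule finite_subset_distinct) (use assms in simp)
qed

lemma grounded_foldr_join:
  assumes "\<And>G. G \<in> set Gs \<Longrightarrow> {} \<in> G \<and> G \<subseteq> Pow I"
  shows "{} \<in> foldr join Gs {{}} \<and> foldr join Gs {{}} \<subseteq> Pow I"
  using assms by (induction Gs) (fastforce simp: join_def)+

lemma grounded_mu_Delta:
  assumes "grounded_set_family S"
  shows "grounded_set_family (mu_Delta \<Phi> S)"
proof -
  have "{} \<in> minor \<Phi> (fst S) i \<and> minor \<Phi> (fst S) i \<subseteq> Pow (snd S)" for i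
    using assms unfolding grounded_set_family_def minor_def by auto
  then show ?thesis
    unfolding grounded_set_family_def mu_Delta_def fst_conv snd_conv
    by (intro grounded_foldr_join) auto
qed

lemma grounded_order_ideals:
  "Field r \<subseteq> I \<Longrightarrow> grounded_set_family (order_ideals r, I)"
  by (auto simp: grounded_set_family_def order_ideals_def)

lemma antipode_single: "antipode (Poly_Mapping.single S 1) = antipode_basis S"
  by (auto simp: antipode_def poly_mapping_eq_iff fun_eq_iff map.rep_eq when_def)

lemma Field_fracturing:
  assumes "partial_order_on I P" "C \<subseteq> I" "partition_on C \<pi>"
  shows "Field {(x, y). \<exists>B\<in>\<pi>. x \<in> B \<and> y \<in> B \<and> (x, y) \<in> P} = C"
  using assms
  unfolding partial_order_on_def preorder_on_def refl_on_def partition_on_def Field_def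
  by auto blast

lemma finite_Good:
  assumes "finite (Field P)"
  shows "finite (Good P)"
proof (rule finite_subset)
  show "Good P \<subseteq> Pow (Field P \<times> Field P)"
    by (auto simp: Good_def fracturing_def Field_def)
  show "finite (Pow (Field P \<times> Field P))"
    using assms by simp
qed

end

theory Submission
  imports Defs
begin

text \<open>
  Write \<open>x \<prec> y\<close> if the block of \<open>x\<close> precedes the block of \<open>y\<close> in a composition \<open>\<Phi>\<close>.  Then
  \<open>\<mu>\<^sub>\<Phi>\<Delta>\<^sub>\<Phi>(J(P))\<close> is \<open>J(Q)\<close>, where \<open>Q\<close> lives on the points \<open>y\<close> having no \<open>z \<le> y\<close> with
  \<open>z \<prec> y\<close>, and relates those in a common block.  The compositions producing a given good \<open>Q\<close> are
  those which keep each component of \<open>Q\<close> inside a block, place a component after every other component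
  that has a point above one of its own, and place each point \<open>x\<close> outside \<open>Q\<close> after at least one point of \<open>Q\<close>
  below \<open>x\<close>.  Hence they arise by inserting the components (in the order in which one fixed such
  composition lists them) and then the remaining points, each insertion being required to take place
  beyond some position in the composition built so far.  If \<open>m\<close> blocks lie beyond that position,
  there are \<open>m\<close> ways to insert into an old block and \<open>m + 1\<close> ways to create a new one, so every
  insertion multiplies the signed count by \<open>-1\<close>.
\<close>

subsection \<open>Set compositions\<close>

text \<open>Set compositions without a named ground set, in a recursive form that allows induction
  on the list of blocks.\<close>

fun comp_list :: "'a set list \<Rightarrow> bool" where
  "comp_list [] \<longleftrightarrow> True"
| "comp_list (B # \<Phi>) \<longleftrightarrow> B \<noteq> {} \<and> B \<inter> \<Union>(set \<Phi>) = {} \<and> comp_list \<Phi>"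

text \<open>A point lying in no block gets the union of all blocks, as if it stood after the last
  one.\<close>

fun preceding :: "'a set list \<Rightarrow> 'a \<Rightarrow> 'a set" where
  "preceding [] x = {}"
| "preceding (B # \<Phi>) x = (if x \<in> B then {} else B \<union> preceding \<Phi> x)"

lemma comp_list_iff:
  "comp_list \<Phi> \<longleftrightarrow> distinct \<Phi> \<and> disjoint (set \<Phi>) \<and> {} \<notin> set \<Phi>"
proof (induction \<Phi>)
  case (Cons B \<Phi>)
  have "B \<inter> \<Union>(set \<Phi>) = {} \<longleftrightarrow> (\<forall>C\<in>set \<Phi>. B \<inter> C = {})"
    by blast
  also have "\<dots> \<longleftrightarrow> B \<notin> set \<Phi> \<and> (\<forall>C\<in>set \<Phi>. C \<noteq> B \<longrightarrow> B \<inter> C = {})" if "B \<noteq> {}"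
    using that by (metis Int_absorb)
  finally show ?case
    using Cons.IH by (auto simp: pairwise_insert disjnt_def Int_commute)
qed simp

lemma set_compositions_iff:
  "\<Phi> \<in> set_compositions I \<longleftrightarrow> comp_list \<Phi> \<and> \<Union>(set \<Phi>) = I"
  by (auto simp: set_compositions_def partition_on_def comp_list_iff)

lemma preceding_subset: "preceding \<Phi> x \<subseteq> \<Union>(set \<Phi>)"
  by (induction \<Phi>) auto

lemma comp_list_same_block:
  "comp_list \<Phi> \<Longrightarrow> B \<in> set \<Phi> \<Longrightarrow> x \<in> B \<Longrightarrow> C \<in> set \<Phi> \<Longrightarrow> x \<in> C \<Longrightarrow> B = C"
  by (induction \<Phi>) auto

lemma preceding_same_block:
  "comp_list \<Phi> \<Longrightarrow> B \<in> set \<Phi> \<Longrightarrow> x \<in> B \<Longrightarrow> y \<in> B \<Longrightarrow> preceding \<Phi> x = preceding \<Phi> y"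
  by (induction \<Phi>) auto

lemma not_preceding_same_block:
  "comp_list \<Phi> \<Longrightarrow> B \<in> set \<Phi> \<Longrightarrow> x \<in> B \<Longrightarrow> y \<in> B \<Longrightarrow> x \<notin> preceding \<Phi> y"
  by (induction \<Phi>) auto

lemma preceding_irrefl: "x \<notin> preceding \<Phi> x"
  by (induction \<Phi>) auto

lemma preceding_trans:
  "x \<in> preceding \<Phi> y \<Longrightarrow> y \<in> preceding \<Phi> z \<Longrightarrow> comp_list \<Phi> \<Longrightarrow> x \<in> preceding \<Phi> z"
proof (induction \<Phi>)
  case (Cons B \<Phi>)
  then show ?case
    using preceding_subset[of \<Phi> z] by (auto split: if_splits)
qed simp

text \<open>Strictness comes from \<open>x\<close> itself, which never precedes itself. The size of
  the preceding set thus serves as a measure of position in later inductions.\<close>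

lemma preceding_psubset:
  assumes "x \<in> preceding \<Phi> y" "comp_list \<Phi>"
  shows "preceding \<Phi> x \<subset> preceding \<Phi> y"
proof -
  have "preceding \<Phi> x \<subseteq> preceding \<Phi> y"
    using preceding_trans[OF _ assms] by auto
  then show ?thesis
    using assms(1) preceding_irrefl[of x \<Phi>] by auto
qed

lemma preceding_total:
  "x \<in> \<Union>(set \<Phi>) \<Longrightarrow> y \<in> \<Union>(set \<Phi>) \<Longrightarrow>
     x \<in> preceding \<Phi> y \<or> y \<in> preceding \<Phi> x \<or> (\<exists>B\<in>set \<Phi>. x \<in> B \<and> y \<in> B)"
  by (induction \<Phi>) auto


subsection \<open>Inserting a chunk\<close>

text \<open>The left inverse of an insertion. Blocks emptied by the deletion are dropped so that a
  composition remains.\<close>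

definition delete_chunk :: "'a set \<Rightarrow> 'a set list \<Rightarrow> 'a set list" where
  "delete_chunk D \<Phi> = filter (\<lambda>B. B \<noteq> {}) (map (\<lambda>B. B - D) \<Phi>)"

text \<open>The recursion pairs, at each block, the insertion of a new block just before it with the
  merger into it; only the insertion after the last block has no partner.\<close>

fun insertions :: "'a set \<Rightarrow> 'a set list \<Rightarrow> 'a set list set" where
  "insertions D [] = {[D]}"
| "insertions D (B # \<Psi>) = {D # B # \<Psi>, (B \<union> D) # \<Psi>} \<union> (#) B ` insertions D \<Psi>"

lemma delete_chunk_simps [simp]:
  "delete_chunk D [] = []"
  "delete_chunk D (B # \<Phi>) = (if B \<subseteq> D then delete_chunk D \<Phi> else (B - D) # delete_chunk D \<Phi>)"
  by (auto simp: delete_chunk_def)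

lemma Union_delete_chunk: "\<Union>(set (delete_chunk D \<Phi>)) = \<Union>(set \<Phi>) - D"
  by (induction \<Phi>) auto

lemma comp_list_delete_chunk: "comp_list \<Phi> \<Longrightarrow> comp_list (delete_chunk D \<Phi>)"
  by (induction \<Phi>) (auto simp: Union_delete_chunk simp del: Union_iff)

lemma preceding_delete_chunk:
  "x \<notin> D \<Longrightarrow> preceding (delete_chunk D \<Phi>) x = preceding \<Phi> x - D"
  by (induction \<Phi>) auto

lemma delete_chunk_block:
  assumes "E \<inter> D = {}" "E \<noteq> {}"
  shows "(\<exists>B\<in>set (delete_chunk D \<Phi>). E \<subseteq> B) \<longleftrightarrow> (\<exists>B\<in>set \<Phi>. E \<subseteq> B)"
  using assms by (induction \<Phi>) auto

lemma delete_chunk_disjoint: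
  "comp_list \<Phi> \<Longrightarrow> \<Union>(set \<Phi>) \<inter> D = {} \<Longrightarrow> delete_chunk D \<Phi> = \<Phi>"
  by (induction \<Phi>) auto

lemma insertionsD:
  assumes "D \<noteq> {}" "D \<inter> \<Union>(set \<Psi>) = {}" "comp_list \<Psi>" "\<Phi> \<in> insertions D \<Psi>"
  shows "comp_list \<Phi> \<and> \<Union>(set \<Phi>) = \<Union>(set \<Psi>) \<union> D \<and> (\<exists>B\<in>set \<Phi>. D \<subseteq> B) \<and> delete_chunk D \<Phi> = \<Psi>"
  using assms
proof (induction \<Psi> arbitrary: \<Phi>)
  case (Cons B \<Psi>)
  have B: "B \<noteq> {}" "B \<inter> D = {}" "B \<inter> \<Union>(set \<Psi>) = {}" and \<Psi>: "comp_list \<Psi>" "\<Union>(set \<Psi>) \<inter> D = {}" "D \<inter> \<Union>(set \<Psi>) = {}"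
    using Cons.prems by auto
  have nB: "\<not> B \<subseteq> D" "B - D = B"
    using B by blast+
  consider "\<Phi> = D # B # \<Psi>" | "\<Phi> = (B \<union> D) # \<Psi>" | \<Phi>' where "\<Phi>' \<in> insertions D \<Psi>" "\<Phi> = B # \<Phi>'"
    using Cons.prems by auto
  then show ?case
  proof cases
    case 1
    then show ?thesis
      using B nB \<Psi> Cons.prems by (auto simp: delete_chunk_disjoint)
  next
    case 2
    have "\<not> B \<union> D \<subseteq> D" "(B \<union> D) - D = B" using nB by blast+
    moreover have "(B \<union> D) \<inter> \<Union>(set \<Psi>) = {}" using B \<Psi> by blast
    ultimately show ?thesis
      using 2 B \<Psi> by (auto simp: delete_chunk_disjoint)
  next
    case 3
    have "comp_list \<Phi>' \<and> \<Union>(set \<Phi>') = \<Union>(set \<Psi>) \<union> D \<and> (\<exists>B\<in>set \<Phi>'. D \<subseteq> B) \<and> delete_chunk D \<Phi>' = \<Psi>"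
      using Cons.IH 3 Cons.prems(1) \<Psi> by blast
    then show ?thesis
      using 3 B nB by auto
  qed
qed auto

text \<open>With \<open>insertionsD\<close>, this identifies the insertions of \<open>D\<close> into
  a composition disjoint from \<open>D\<close> as the fibre of deletion over it, taken among the
  compositions that keep \<open>D\<close> inside one block.\<close>

lemma insertionsI:
  assumes "D \<noteq> {}" "comp_list \<Phi>" "\<exists>B\<in>set \<Phi>. D \<subseteq> B"
  shows "\<Phi> \<in> insertions D (delete_chunk D \<Phi>)"
  using assms
proof (induction \<Phi>)
  case (Cons B \<Phi>)
  show ?case
  proof (cases "D \<subseteq> B")
    case True
    then have *: "delete_chunk D \<Phi> = \<Phi>"
      using Cons.prems by (intro delete_chunk_disjoint) auto
    show ?thesis
    proof (cases "B = D")
      case True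
      \<comment> \<open>A block equal to \<open>D\<close> is a newly created one: it comes from the
        base clause if nothing follows, and from an insertion before the next block
        otherwise.\<close>
      then show ?thesis using * by (cases \<Phi>) auto
    next
      case False
      then have "\<not> B \<subseteq> D" "(B - D) \<union> D = B" using True by auto
      then show ?thesis using * by simp
    qed
  next
    case False
    then obtain B' where "B' \<in> set \<Phi>" "D \<subseteq> B'" using Cons.prems by auto
    moreover from this have "B \<inter> D = {}" "B \<noteq> {}" using Cons.prems by auto
    then have "\<not> B \<subseteq> D" "B - D = B" by blast+
    ultimately show ?thesis using Cons by auto
  qed
qed simp

lemma finite_insertions: "finite (insertions D \<Psi>)"
  by (induction \<Psi>) auto

text \<open>The first two insertions into \<open>B # \<Psi>\<close> have opposite signs and agree on what precedes \<open>D\<close>.\<close>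

lemma sum_insertions:
  assumes "D \<noteq> {}" "D \<inter> \<Union>(set \<Psi>) = {}" "comp_list \<Psi>" "mono G" "G (\<Union>(set \<Psi>))"
  shows "(\<Sum>\<Phi> | \<Phi> \<in> insertions D \<Psi> \<and> (\<forall>x\<in>D. G (preceding \<Phi> x)). (-1) ^ length \<Phi>) =
           - ((-1) ^ length \<Psi> :: 'k::comm_ring_1)"
  using assms
proof (induction \<Psi> arbitrary: G)
  case Nil
  \<comment> \<open>The unpaired insertion puts \<open>D\<close> after everything else. The last
    premise admits it, and it lengthens the list by one, which gives the sign.\<close>
  then have "{\<Phi>. \<Phi> = [D] \<and> (\<forall>x\<in>D. G (preceding \<Phi> x))} = {[D]}" by auto
  then show ?case by simp
next
  case (Cons B \<Psi>)
  \<comment> \<open>Once \<open>D\<close> is placed beyond \<open>B\<close>, the set preceding it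
    contains \<open>B\<close>; \<open>G'\<close> is the condition left on the remainder.\<close>
  define G' where "G' X = G (B \<union> X)" for X
  have "mono G'"
    using Cons.prems(4) unfolding mono_def G'_def by (metis Un_mono order_refl)
  moreover have "G' (\<Union>(set \<Psi>))" using Cons.prems by (simp add: G'_def)
  moreover have \<Psi>: "D \<inter> \<Union>(set \<Psi>) = {}" "comp_list \<Psi>"
    using Cons.prems by auto
  ultimately have IH: "(\<Sum>\<Phi> | \<Phi> \<in> insertions D \<Psi> \<and> (\<forall>x\<in>D. G' (preceding \<Phi> x)). (-1) ^ length \<Phi>) =
           - ((-1) ^ length \<Psi> :: 'k)"
    using Cons.IH[OF Cons.prems(1) \<Psi>] by blast
  define T where "T = {\<Phi>. \<Phi> \<in> insertions D \<Psi> \<and> (\<forall>x\<in>D. G' (preceding \<Phi> x))}"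
  define U where "U = (if G {} then {D # B # \<Psi>, (B \<union> D) # \<Psi>} else {})"
  have D: "x \<notin> B" if "x \<in> D" for x
    using that Cons.prems by auto
  have S: "{\<Phi>. \<Phi> \<in> insertions D (B # \<Psi>) \<and> (\<forall>x\<in>D. G (preceding \<Phi> x))} = U \<union> (#) B ` T"
    using D Cons.prems(1) by (auto simp: U_def T_def G'_def)
  have ne: "D \<noteq> B" "B \<union> D \<noteq> B" using D Cons.prems(1) by auto
  have finT: "finite T" using finite_insertions[of D \<Psi>] by (simp add: T_def)
  have dis: "U \<inter> (#) B ` T = {}"
    using ne by (auto simp: U_def)
  have "length (D # B # \<Psi>) \<noteq> length ((B \<union> D) # \<Psi>)" by simp
  then have "D # B # \<Psi> \<noteq> (B \<union> D) # \<Psi>" by metis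
  then have U: "(\<Sum>\<Phi>\<in>U. (-1) ^ length \<Phi>) = (0::'k)"
    by (simp add: U_def)
  have "(\<Sum>\<Phi>\<in>U \<union> (#) B ` T. (-1) ^ length \<Phi>) = (\<Sum>\<Phi>\<in>(#) B ` T. (-1) ^ length \<Phi> :: 'k)"
    using finT dis U by (subst sum.union_disjoint) (auto simp: U_def)
  also have "\<dots> = - (\<Sum>\<Phi>\<in>T. (-1) ^ length \<Phi>)"
    by (subst sum.reindex) (auto simp: sum_negf)
  finally show ?case
    using IH unfolding S T_def by simp
qed


subsection \<open>Signed counts of compositions built from chunks\<close>

inductive chunks :: "('a set \<Rightarrow> 'a set \<Rightarrow> bool) \<Rightarrow> 'a set set \<Rightarrow> bool" for G where
  empty: "chunks G {}"
| insert: "chunks G K \<Longrightarrow> D \<noteq> {} \<Longrightarrow> D \<inter> \<Union>K = {} \<Longrightarrow> mono (G D) \<Longrightarrow>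
     (\<And>X. G D X \<longleftrightarrow> G D (X \<inter> \<Union>K)) \<Longrightarrow> G D (\<Union>K) \<Longrightarrow> chunks G (insert D K)"

definition chunk_compositions :: "('a set \<Rightarrow> 'a set \<Rightarrow> bool) \<Rightarrow> 'a set set \<Rightarrow> 'a set list set" where
  "chunk_compositions G K = {\<Phi>\<in>set_compositions (\<Union>K).
     \<forall>D\<in>K. (\<exists>B\<in>set \<Phi>. D \<subseteq> B) \<and> (\<forall>x\<in>D. G D (preceding \<Phi> x))}"

text \<open>Intersecting first with a larger union does not alter the trace on a smaller one, so
  each condition stays local as chunks are added.\<close>

lemma chunksD:
  assumes "chunks G K"
  shows "finite K \<and> {} \<notin> K \<and> (\<forall>D\<in>K. \<forall>X. G D X \<longleftrightarrow> G D (X \<inter> \<Union>K))"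
  using assms
proof induction
  case (insert K D)
  have "G E X \<longleftrightarrow> G E (X \<inter> \<Union>(insert D K))" if "E \<in> insert D K" for E X
  proof -
    have "G E Y \<longleftrightarrow> G E (Y \<inter> \<Union>K)" for Y
      using that insert by auto
    then have "G E X \<longleftrightarrow> G E (X \<inter> \<Union>K)" "G E (X \<inter> \<Union>(insert D K)) \<longleftrightarrow> G E (X \<inter> \<Union>(insert D K) \<inter> \<Union>K)"
      by blast+
    moreover have "X \<inter> \<Union>(insert D K) \<inter> \<Union>K = X \<inter> \<Union>K" by auto
    ultimately show ?thesis by simp
  qed
  then show ?case using insert.IH insert.hyps(2) by blast
qed simp

text \<open>Deleting the chunk \<open>D\<close> inserted last maps the compositions for
  \<open>insert D K\<close> to those for \<open>K\<close>. The fibre over \<open>\<Psi>\<close>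
  consists of the admissible insertions of \<open>D\<close>, so by \<open>sum_insertions\<close>
  each chunk contributes a factor -1.\<close>

lemma sum_chunk_compositions:
  assumes "chunks G K" "finite (\<Union>K)"
  shows "(\<Sum>\<Phi>\<in>chunk_compositions G K. (-1) ^ length \<Phi>) = ((-1) ^ card K :: 'k::comm_ring_1)"
  using assms
proof induction
  case empty
  have "set_compositions ({} :: 'a set) = {[]}"
    by (auto simp: set_compositions_iff) (metis comp_list.simps(2) list.exhaust list.set_intros(1))
  then have "chunk_compositions G {} = {[]}"
    by (auto simp: chunk_compositions_def)
  then show ?case by simp
next
  case (insert K D)
  note K = chunksD[OF insert.hyps(1)]
  have fin: "finite (chunk_compositions G L)" if "finite (\<Union>L)" for L
    using finite_set_compositions[OF that] by (simp add: chunk_compositions_def)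
  have DE: "D \<inter> E = {}" "E \<noteq> {}" if "E \<in> K" for E
    using that insert.hyps K by auto
  \<comment> \<open>Deleting \<open>D\<close> changes no preceding set inside
    \<open>\<Union>K\<close>, and the conditions of the earlier chunks look only there.\<close>
  have GE: "G E (preceding (delete_chunk D \<Phi>) x) \<longleftrightarrow> G E (preceding \<Phi> x)" if "E \<in> K" "x \<in> E" for E x \<Phi>
  proof -
    have "x \<notin> D" using DE that by auto
    then have "preceding (delete_chunk D \<Phi>) x \<inter> \<Union>K = preceding \<Phi> x \<inter> \<Union>K"
      using insert.hyps by (auto simp: preceding_delete_chunk)
    then show ?thesis using K that by metis
  qed
  have old: "(\<forall>E\<in>K. (\<exists>B\<in>set (delete_chunk D \<Phi>). E \<subseteq> B) \<and> (\<forall>x\<in>E. G E (preceding (delete_chunk D \<Phi>) x)))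
      \<longleftrightarrow> (\<forall>E\<in>K. (\<exists>B\<in>set \<Phi>. E \<subseteq> B) \<and> (\<forall>x\<in>E. G E (preceding \<Phi> x)))" for \<Phi>
    using GE DE delete_chunk_block[of _ D \<Phi>] by (simp add: Int_commute)
  have U: "\<Union>(insert D K) - D = \<Union>K" "D \<union> \<Union>K = \<Union>(insert D K)"
    using insert.hyps by auto
  have sub: "delete_chunk D ` chunk_compositions G (insert D K) \<subseteq> chunk_compositions G K"
  proof
    fix \<Psi> assume "\<Psi> \<in> delete_chunk D ` chunk_compositions G (insert D K)"
    then obtain \<Phi> where \<Phi>: "\<Psi> = delete_chunk D \<Phi>" "\<Phi> \<in> chunk_compositions G (insert D K)" by auto
    then have "\<forall>E\<in>K. (\<exists>B\<in>set \<Phi>. E \<subseteq> B) \<and> (\<forall>x\<in>E. G E (preceding \<Phi> x))"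
      by (simp add: chunk_compositions_def)
    moreover have "\<Psi> \<in> set_compositions (\<Union>K)"
    proof -
      have "comp_list \<Phi>" "\<Union>(set \<Phi>) = \<Union>(insert D K)"
        using \<Phi>(2) by (simp_all add: chunk_compositions_def set_compositions_iff)
      then show ?thesis
        unfolding set_compositions_iff \<Phi>(1) Union_delete_chunk using U(1) comp_list_delete_chunk by metis
    qed
    ultimately show "\<Psi> \<in> chunk_compositions G K"
      using \<Phi> old by (simp add: chunk_compositions_def)
  qed
  have fib: "{\<Phi>. \<Phi> \<in> chunk_compositions G (insert D K) \<and> delete_chunk D \<Phi> = \<Psi>} =
      {\<Phi>. \<Phi> \<in> insertions D \<Psi> \<and> (\<forall>x\<in>D. G D (preceding \<Phi> x))}"
    if \<Psi>: "\<Psi> \<in> chunk_compositions G K" for \<Psi>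
  proof (intro set_eqI iffI CollectI; elim CollectE conjE)
    fix \<Phi> assume "\<Phi> \<in> chunk_compositions G (insert D K)" "delete_chunk D \<Phi> = \<Psi>"
    then show "\<Phi> \<in> insertions D \<Psi> \<and> (\<forall>x\<in>D. G D (preceding \<Phi> x))"
      using insertionsI[of D \<Phi>] insert.hyps by (auto simp: chunk_compositions_def set_compositions_iff)
  next
    fix \<Phi> assume *: "\<Phi> \<in> insertions D \<Psi>" "\<forall>x\<in>D. G D (preceding \<Phi> x)"
    have "comp_list \<Psi>" "\<Union>(set \<Psi>) = \<Union>K"
      using \<Psi> by (auto simp: chunk_compositions_def set_compositions_iff)
    then have i: "comp_list \<Phi> \<and> \<Union>(set \<Phi>) = \<Union>K \<union> D \<and> (\<exists>B\<in>set \<Phi>. D \<subseteq> B) \<and> delete_chunk D \<Phi> = \<Psi>"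
      using insertionsD[of D \<Psi> \<Phi>] * insert.hyps by simp
    then have "\<forall>E\<in>K. (\<exists>B\<in>set \<Phi>. E \<subseteq> B) \<and> (\<forall>x\<in>E. G E (preceding \<Phi> x))"
      using \<Psi> old[of \<Phi>] by (simp add: chunk_compositions_def)
    then show "\<Phi> \<in> chunk_compositions G (insert D K) \<and> delete_chunk D \<Phi> = \<Psi>"
      using i * by (auto simp: chunk_compositions_def set_compositions_iff)
  qed
  have "(\<Sum>\<Phi>\<in>chunk_compositions G (insert D K). (-1) ^ length \<Phi> :: 'k) =
      (\<Sum>\<Psi>\<in>chunk_compositions G K.
        \<Sum>\<Phi> | \<Phi> \<in> chunk_compositions G (insert D K) \<and> delete_chunk D \<Phi> = \<Psi>. (-1) ^ length \<Phi>)"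
    using fin insert.prems sub by (intro sum.group[symmetric]) auto
  also have "\<dots> = (\<Sum>\<Psi>\<in>chunk_compositions G K. - ((-1) ^ length \<Psi>))"
  proof (intro sum.cong refl)
    fix \<Psi> assume \<Psi>: "\<Psi> \<in> chunk_compositions G K"
    then have "comp_list \<Psi>" "\<Union>(set \<Psi>) = \<Union>K"
      by (auto simp: chunk_compositions_def set_compositions_iff)
    then show "(\<Sum>\<Phi> | \<Phi> \<in> chunk_compositions G (insert D K) \<and> delete_chunk D \<Phi> = \<Psi>. (-1) ^ length \<Phi>) =
        - ((-1) ^ length \<Psi> :: 'k)"
      unfolding fib[OF \<Psi>] using insert.hyps by (intro sum_insertions) auto
  qed
  also have "\<dots> = - ((-1) ^ card K)"
    using insert by (simp add: sum_negf)
  also have "D \<notin> K"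
    using insert.hyps by auto
  then have "- ((-1) ^ card K) = ((-1) ^ card (insert D K) :: 'k)"
    using K by simp
  finally show ?case .
qed


subsection \<open>The fracturing of a composition\<close>

text \<open>Points outside the ground set belong vacuously, which is why the field of the fracturing
  is an intersection with \<open>I\<close>.\<close>

definition unpreceded :: "'a rel \<Rightarrow> 'a set list \<Rightarrow> 'a set" where
  "unpreceded P \<Phi> = {y. \<forall>z. (z, y) \<in> P \<longrightarrow> z \<notin> preceding \<Phi> y}"

text \<open>Restricting the upper point is enough: the lower one shares its block, hence its
  preceding set, and transitivity makes it unpreceded too.\<close>

definition fracture :: "'a rel \<Rightarrow> 'a set list \<Rightarrow> 'a rel" where
  "fracture P \<Phi> = {(x, y) \<in> P. y \<in> unpreceded P \<Phi> \<and> (\<exists>B\<in>set \<Phi>. x \<in> B \<and> y \<in> B)}"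

text \<open>Having empty intersection with the first block can be imposed on the family beforehand,
  so the join of minors becomes recursive in the list.\<close>

lemma foldr_join_minor_Cons:
  "foldr join (map (minor (B # \<Phi>) F) [0..<length (B # \<Phi>)]) {{}} =
     join {A \<inter> B | A. A \<in> F}
       (foldr join (map (minor \<Phi> {A \<in> F. A \<inter> B = {}}) [0..<length \<Phi>]) {{}})"
proof -
  have "minor (B # \<Phi>) F (Suc i) = minor \<Phi> {A \<in> F. A \<inter> B = {}} i" for i
    unfolding minor_def All_less_Suc2 by simp
  moreover have "minor (B # \<Phi>) F 0 = {A \<inter> B | A. A \<in> F}"
    by (auto simp: minor_def)
  moreover have "[0..<length (B # \<Phi>)] = 0 # map Suc [0..<length \<Phi>]"
    by (simp add: map_Suc_upt upt_conv_Cons del: upt_Suc)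
  ultimately show ?thesis by (simp add: comp_def del: upt_Suc)
qed

text \<open>No relation crosses between the two fields, so the two parts of an ideal are chosen
  independently.\<close>

lemma order_ideals_Un:
  assumes "Field r \<inter> Field s = {}"
  shows "order_ideals (r \<union> s) = join (order_ideals r) (order_ideals s)"
proof (intro equalityI subsetI)
  fix A assume A: "A \<in> order_ideals (r \<union> s)"
  have "A \<inter> Field r \<in> order_ideals r" "A \<inter> Field s \<in> order_ideals s"
    using A by (auto simp: order_ideals_def Field_def)
  moreover have "A = (A \<inter> Field r) \<union> (A \<inter> Field s)"
    using A by (auto simp: order_ideals_def)
  ultimately show "A \<in> join (order_ideals r) (order_ideals s)"
    unfolding join_def by blast
next
  fix A assume "A \<in> join (order_ideals r) (order_ideals s)"
  then obtain X Y where "A = X \<union> Y" "X \<in> order_ideals r" "Y \<in> order_ideals s"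
    by (auto simp: join_def)
  moreover from this have "x \<notin> Field s" if "x \<in> X" for x
    using that assms by (auto simp: order_ideals_def)
  moreover from calculation have "x \<notin> Field r" if "x \<in> Y" for x
    using that assms by (auto simp: order_ideals_def)
  ultimately show "A \<in> order_ideals (r \<union> s)"
    unfolding order_ideals_def by (auto dest: FieldI1 FieldI2)
qed

text \<open>A point of the ground set lies in an ideal avoiding \<open>U\<close> exactly when
  nothing below it is in \<open>U\<close>; the principal ideal decides this.\<close>

lemma order_ideals_restrict:
  assumes "partial_order_on I P" "B \<subseteq> I"
  shows "{A \<inter> B | A. A \<in> order_ideals P \<and> A \<inter> U = {}} =
    order_ideals {(x, y) \<in> P. x \<in> B \<and> y \<in> B \<and> (\<forall>z. (z, y) \<in> P \<longrightarrow> z \<notin> U)}"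
    (is "?L = order_ideals ?r")
proof (intro equalityI subsetI)
  have refl: "(x, x) \<in> P" if "x \<in> I" for x
    using assms that by (auto simp: partial_order_on_def preorder_on_def refl_on_def)
  have trans: "(x, z) \<in> P" if "(x, y) \<in> P" "(y, z) \<in> P" for x y z
    using assms that by (auto simp: partial_order_on_def preorder_on_def trans_def)
  {
    fix X assume "X \<in> ?L"
    then obtain A where A: "A \<in> order_ideals P" "A \<inter> U = {}" "X = A \<inter> B" by auto
    have "(x, x) \<in> ?r" if "x \<in> X" for x
      using that A assms(2) refl by (auto simp: order_ideals_def)
    then have "X \<subseteq> Field ?r" by (auto simp: Field_def)
    then show "X \<in> order_ideals ?r"
      using A by (auto simp: order_ideals_def)
  next
    fix X assume X: "X \<in> order_ideals ?r"
    have XB: "x \<in> B \<and> (\<forall>z. (z, x) \<in> P \<longrightarrow> z \<notin> U)" if "x \<in> X" for x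
    proof -
      have "x \<in> Field ?r" using X that by (auto simp: order_ideals_def)
      then show ?thesis using trans by (auto simp: Field_def)
    qed
    \<comment> \<open>The down-closure of \<open>X\<close> in \<open>P\<close> meets
      \<open>B\<close> in \<open>X\<close> alone, since a point of \<open>B\<close> below a point of
      \<open>X\<close> is also below it in the restricted order.\<close>
    define A where "A = {w. \<exists>x\<in>X. (w, x) \<in> P}"
    have "A \<in> order_ideals P"
      using trans by (auto simp: order_ideals_def A_def Field_def)
    moreover have "A \<inter> U = {}" using XB by (auto simp: A_def)
    moreover have "X = A \<inter> B"
    proof (intro equalityI subsetI)
      fix x assume "x \<in> X"
      then show "x \<in> A \<inter> B" using XB refl assms(2) unfolding A_def by blast
    next
      fix w assume "w \<in> A \<inter> B"
      then obtain x where x: "x \<in> X" "(w, x) \<in> P" "w \<in> B" by (auto simp: A_def)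
      then have "(w, x) \<in> ?r" using XB by auto
      then show "w \<in> X" using X x unfolding order_ideals_def by blast
    qed
    ultimately show "X \<in> ?L" by blast
  }
qed

text \<open>
  Splitting off the first block restricts the family to the ideals avoiding it, so the induction
  has to carry the set \<open>U\<close> of points avoided so far.
\<close>

lemma foldr_join_minor_order_ideals:
  assumes "partial_order_on I P" "comp_list \<Phi>" "\<Union>(set \<Phi>) \<subseteq> I"
  shows "foldr join (map (minor \<Phi> {A \<in> order_ideals P. A \<inter> U = {}}) [0..<length \<Phi>]) {{}} =
    order_ideals {(x, y) \<in> P. (\<forall>z. (z, y) \<in> P \<longrightarrow> z \<notin> U \<union> preceding \<Phi> y) \<and> (\<exists>B\<in>set \<Phi>. x \<in> B \<and> y \<in> B)}"
  using assms(2,3)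
proof (induction \<Phi> arbitrary: U)
  case Nil
  show ?case by (auto simp: order_ideals_def)
next
  case (Cons B \<Phi>)
  let ?r = "{(x, y) \<in> P. x \<in> B \<and> y \<in> B \<and> (\<forall>z. (z, y) \<in> P \<longrightarrow> z \<notin> U)}"
  let ?s = "{(x, y) \<in> P. (\<forall>z. (z, y) \<in> P \<longrightarrow> z \<notin> (U \<union> B) \<union> preceding \<Phi> y) \<and>
    (\<exists>B\<in>set \<Phi>. x \<in> B \<and> y \<in> B)}"
  let ?t = "{(x, y) \<in> P. (\<forall>z. (z, y) \<in> P \<longrightarrow> z \<notin> U \<union> preceding (B # \<Phi>) y) \<and>
    (\<exists>B\<in>set (B # \<Phi>). x \<in> B \<and> y \<in> B)}"
  have B: "B \<inter> \<Union>(set \<Phi>) = {}" using Cons.prems by simp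
  \<comment> \<open>For \<open>y\<close> in \<open>B\<close> nothing precedes \<open>y\<close>; for
    a point of a later block, \<open>B\<close> moves into the avoided set.\<close>
  have t: "?t = ?r \<union> ?s"
  proof (intro set_eqI)
    fix p :: "'a \<times> 'a"
    obtain x y where p: "p = (x, y)" by force
    show "p \<in> ?t \<longleftrightarrow> p \<in> ?r \<union> ?s"
      unfolding p using B by (cases "y \<in> B") (auto 0 3)
  qed
  have "Field ?r \<subseteq> B" "Field ?s \<subseteq> \<Union>(set \<Phi>)" by (auto simp: Field_def)
  then have "Field ?r \<inter> Field ?s = {}" using B by blast
  then have "order_ideals ?t = join (order_ideals ?r) (order_ideals ?s)"
    unfolding t by (rule order_ideals_Un)
  moreover have "{A \<in> {A \<in> order_ideals P. A \<inter> U = {}}. A \<inter> B = {}} =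
      {A \<in> order_ideals P. A \<inter> (U \<union> B) = {}}"
    by auto
  moreover have "{A \<inter> B | A. A \<in> {A \<in> order_ideals P. A \<inter> U = {}}} = order_ideals ?r"
    using order_ideals_restrict[OF assms(1), of B U] Cons.prems by simp
  ultimately show ?case
    unfolding foldr_join_minor_Cons using Cons.IH[of "U \<union> B"] Cons.prems by simp
qed

lemma mu_Delta_order_ideals:
  assumes "partial_order_on I P" "\<Phi> \<in> set_compositions I"
  shows "mu_Delta \<Phi> (order_ideals P, I) = (order_ideals (fracture P \<Phi>), I)"
proof -
  have "fracture P \<Phi> =
      {(x, y) \<in> P. (\<forall>z. (z, y) \<in> P \<longrightarrow> z \<notin> {} \<union> preceding \<Phi> y) \<and> (\<exists>B\<in>set \<Phi>. x \<in> B \<and> y \<in> B)}"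
    by (auto simp: fracture_def unpreceded_def)
  then show ?thesis
    using foldr_join_minor_order_ideals[OF assms(1), of \<Phi> "{}"] assms(2)
    by (simp add: mu_Delta_def set_compositions_iff)
qed

lemma Field_fracture:
  assumes "partial_order_on I P" "\<Phi> \<in> set_compositions I"
  shows "Field (fracture P \<Phi>) = I \<inter> unpreceded P \<Phi>"
proof (intro equalityI subsetI)
  have refl: "(x, x) \<in> P" if "x \<in> I" for x
    using assms that by (auto simp: partial_order_on_def preorder_on_def refl_on_def)
  have trans: "(x, z) \<in> P" if "(x, y) \<in> P" "(y, z) \<in> P" for x y z
    using assms that by (auto simp: partial_order_on_def preorder_on_def trans_def)
  have \<Phi>: "comp_list \<Phi>" "\<Union>(set \<Phi>) = I" using assms by (auto simp: set_compositions_iff)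
  {
    fix x assume "x \<in> I \<inter> unpreceded P \<Phi>"
    then have "(x, x) \<in> fracture P \<Phi>" using refl \<Phi> by (auto simp: fracture_def)
    then show "x \<in> Field (fracture P \<Phi>)" by (auto simp: Field_def)
  next
    fix w assume "w \<in> Field (fracture P \<Phi>)"
    then obtain x y where w: "w = x \<or> w = y" "(x, y) \<in> fracture P \<Phi>" by (auto simp: Field_def)
    then obtain B where B: "(x, y) \<in> P" "y \<in> unpreceded P \<Phi>" "B \<in> set \<Phi>" "x \<in> B" "y \<in> B"
      by (auto simp: fracture_def)
    then have "preceding \<Phi> x = preceding \<Phi> y" using preceding_same_block \<Phi> by metis
    then have "x \<in> unpreceded P \<Phi>" using B trans by (auto simp: unpreceded_def)
    then show "w \<in> I \<inter> unpreceded P \<Phi>" using B w \<Phi> by auto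
  }
qed

lemma fracturing_fracture:
  assumes "partial_order_on I P" "\<Phi> \<in> set_compositions I"
  shows "fracturing P (fracture P \<Phi>)"
proof -
  let ?C = "Field (fracture P \<Phi>)"
  \<comment> \<open>The summands live on the traces of the blocks; empty traces are discarded
    because a partition has no empty class.\<close>
  let ?\<pi> = "(\<lambda>B. B \<inter> ?C) ` set \<Phi> - {{}}"
  have \<Phi>: "comp_list \<Phi>" "\<Union>(set \<Phi>) = I" using assms by (auto simp: set_compositions_iff)
  have "?C \<subseteq> Field P" by (auto simp: fracture_def Field_def)
  moreover have "partition_on ?C ?\<pi>"
  proof (rule partition_onI)
    show "\<Union>?\<pi> = ?C" using \<Phi> Field_fracture[OF assms] by auto
    fix p q assume pq: "p \<in> ?\<pi>" "q \<in> ?\<pi>" "p \<noteq> q"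
    show "disjnt p q"
    proof -
      obtain A B where "A \<in> set \<Phi>" "p = A \<inter> ?C" "B \<in> set \<Phi>" "q = B \<inter> ?C"
        using pq(1,2) by blast
      moreover from this have "A \<inter> B = {}"
        using pq(3) comp_list_same_block[OF \<Phi>(1)] by blast
      ultimately show ?thesis by (auto simp: disjnt_def)
    qed
  qed auto
  moreover have "(x, y) \<in> fracture P \<Phi> \<longleftrightarrow> (\<exists>B\<in>?\<pi>. x \<in> B \<and> y \<in> B \<and> (x, y) \<in> P)" for x y
  proof
    assume *: "(x, y) \<in> fracture P \<Phi>"
    then obtain B where "B \<in> set \<Phi>" "x \<in> B" "y \<in> B" by (auto simp: fracture_def)
    moreover have "x \<in> ?C" "y \<in> ?C" "(x, y) \<in> P" using * by (auto simp: Field_def fracture_def)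
    ultimately show "\<exists>B\<in>?\<pi>. x \<in> B \<and> y \<in> B \<and> (x, y) \<in> P" by blast
  next
    assume "\<exists>B\<in>?\<pi>. x \<in> B \<and> y \<in> B \<and> (x, y) \<in> P"
    then show "(x, y) \<in> fracture P \<Phi>"
      using Field_fracture[OF assms] by (auto simp: fracture_def)
  qed
  then have "fracture P \<Phi> = {(x, y). \<exists>B\<in>?\<pi>. x \<in> B \<and> y \<in> B \<and> (x, y) \<in> P}"
    unfolding set_eq_iff split_paired_All mem_Collect_eq prod.case by blast
  ultimately show ?thesis unfolding fracturing_def by blast
qed

section \<open>Good fracturings and their recovery from order ideals\<close>

lemma fracturing_partial_order:
  assumes "partial_order_on I P" "fracturing P Q"
  shows "refl_on (Field Q) Q" "trans Q" "antisym Q"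
proof -
  obtain C \<pi> where C: "C \<subseteq> Field P" "partition_on C \<pi>"
    and Q: "Q = {(x, y). \<exists>B\<in>\<pi>. x \<in> B \<and> y \<in> B \<and> (x, y) \<in> P}"
    using assms(2) unfolding fracturing_def by auto
  have P: "\<And>x. x \<in> I \<Longrightarrow> (x, x) \<in> P" "trans P" "antisym P" "P \<subseteq> I \<times> I"
    using assms(1) by (auto simp: partial_order_on_def preorder_on_def refl_on_def)
  show "refl_on (Field Q) Q"
    using P(1,4) by (auto simp: Q refl_on_def Field_def)
  show "antisym Q"
    using P(3) by (auto simp: Q antisym_def)
  show "trans Q"
  proof (rule transI)
    fix x y z assume "(x, y) \<in> Q" "(y, z) \<in> Q"
    then obtain B B' where B: "B \<in> \<pi>" "x \<in> B" "y \<in> B" "(x, y) \<in> P" "B' \<in> \<pi>" "y \<in> B'" "z \<in> B'" "(y, z) \<in> P"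
      by (auto simp: Q)
    \<comment> \<open>The middle point \<open>y\<close> lies in both classes of the
      partition.\<close>
    then have "B = B'" using C(2) by (auto simp: partition_on_def disjoint_def)
    then show "(x, z) \<in> Q" using B P(2) by (auto simp: Q dest: transD)
  qed
qed

text \<open>The ideals determine the order: their union is the field, and \<open>x\<close> is below
  \<open>y\<close> iff every ideal containing \<open>y\<close> contains \<open>x\<close>. The
  principal ideal of \<open>y\<close> gives the nontrivial direction.\<close>

lemma order_ideals_inject:
  assumes "refl_on (Field r) r" "trans r" "refl_on (Field s) s" "trans s"
    and "order_ideals r = order_ideals s"
  shows "r = s"
proof -
  have le: "(x, y) \<in> t \<longleftrightarrow> y \<in> \<Union>(order_ideals t) \<and> (\<forall>A\<in>order_ideals t. y \<in> A \<longrightarrow> x \<in> A)"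
    if t: "refl_on (Field t) t" "trans t" for t :: "'a rel" and x y
  proof
    assume xy: "(x, y) \<in> t"
    have "Field t \<in> order_ideals t" by (auto simp: order_ideals_def Field_def)
    moreover have "y \<in> Field t" using xy by (auto simp: Field_def)
    ultimately show "y \<in> \<Union>(order_ideals t) \<and> (\<forall>A\<in>order_ideals t. y \<in> A \<longrightarrow> x \<in> A)"
      using xy by (auto simp: order_ideals_def)
  next
    assume *: "y \<in> \<Union>(order_ideals t) \<and> (\<forall>A\<in>order_ideals t. y \<in> A \<longrightarrow> x \<in> A)"
    then have "y \<in> Field t" by (auto simp: order_ideals_def)
    then have "(y, y) \<in> t" using t by (auto simp: refl_on_def)
    moreover have "{z. (z, y) \<in> t} \<in> order_ideals t"
      using t by (auto simp: order_ideals_def Field_def dest: transD)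
    ultimately show "(x, y) \<in> t" using * by auto
  qed
  have "p \<in> r \<longleftrightarrow> p \<in> s" for p
    using le[OF assms(1,2)] le[OF assms(3,4)] assms(5) by (cases p) simp
  then show ?thesis by blast
qed

text \<open>A fracturing is determined by its ideals, so the one witnessed by \<open>\<Phi>\<close>
  can only be \<open>fracture P \<Phi>\<close>.\<close>

lemma Good_eq:
  assumes P: "partial_order_on I P"
  shows "Good P = fracture P ` set_compositions I"
proof -
  have I: "Field P = I"
    using P by (auto simp: partial_order_on_def preorder_on_def refl_on_def Field_def)
  have "Q = fracture P \<Phi>"
    if "fracturing P Q" "\<Phi> \<in> set_compositions I" "order_ideals (fracture P \<Phi>) = order_ideals Q" for Q \<Phi>
    using that fracturing_partial_order[OF P] fracturing_fracture[OF P]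
    by (intro order_ideals_inject) auto
  then show ?thesis
    unfolding Good_def I using mu_Delta_order_ideals[OF P] fracturing_fracture[OF P] by auto
qed

lemma inj_on_order_ideals_Good:
  assumes "partial_order_on I P"
  shows "inj_on order_ideals (Good P)"
proof (rule inj_onI)
  fix Q R assume "Q \<in> Good P" "R \<in> Good P" and eq: "order_ideals Q = order_ideals R"
  then have "fracturing P Q" "fracturing P R" by (simp_all add: Good_def)
  then show "Q = R"
    using eq by (intro order_ideals_inject fracturing_partial_order[OF assms])
qed


subsection \<open>Components\<close>

text \<open>Induction on the size of the interval from \<open>x\<close> to \<open>y\<close>: a pair
  that is not a cover splits at an intermediate point.\<close>

lemma finite_order_hasse:
  assumes "finite (Field r)" "refl_on (Field r) r" "trans r" "antisym r" "(x, y) \<in> r"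
  shows "(x, y) \<in> (hasse_diagram r)\<^sup>*"
  using assms(5)
proof (induction "card {z. (x, z) \<in> r \<and> (z, y) \<in> r}" arbitrary: x y rule: less_induct)
  case less
  show ?case
  proof (cases "x = y \<or> (x, y) \<in> hasse_diagram r")
    case False
    then obtain z where z: "z \<noteq> x" "z \<noteq> y" "(x, z) \<in> r" "(z, y) \<in> r"
      using less.prems by (auto simp: hasse_diagram_def)
    have fin: "finite {w. (x, w) \<in> r \<and> (w, y) \<in> r}"
      by (rule finite_subset[OF _ assms(1)]) (auto simp: Field_def)
    have refl: "(x, x) \<in> r" "(y, y) \<in> r"
      using assms(2) less.prems by (auto simp: refl_on_def Field_def)
    \<comment> \<open>Antisymmetry removes an end point from each of the two subintervals, so both
      are strictly smaller.\<close>
    have "y \<notin> {w. (x, w) \<in> r \<and> (w, z) \<in> r}" "x \<notin> {w. (z, w) \<in> r \<and> (w, y) \<in> r}"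
      using z assms(4) by (auto simp: antisym_def)
    then have "{w. (x, w) \<in> r \<and> (w, z) \<in> r} \<subset> {w. (x, w) \<in> r \<and> (w, y) \<in> r}"
      "{w. (z, w) \<in> r \<and> (w, y) \<in> r} \<subset> {w. (x, w) \<in> r \<and> (w, y) \<in> r}"
      using refl less.prems z assms(3) unfolding trans_def by blast+
    then show ?thesis
      using less.hyps z psubset_card_mono[OF fin] by (meson rtrancl_trans)
  qed auto
qed

text \<open>The closure is reflexive on the whole type, hence \<open>UNIV\<close>; the components
  are those of its classes that meet the field.\<close>

lemma equiv_hasse: "equiv UNIV ((hasse_diagram r \<union> (hasse_diagram r)\<inverse>)\<^sup>*)"
proof (rule equivI)
  show "sym ((hasse_diagram r \<union> (hasse_diagram r)\<inverse>)\<^sup>*)"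
    by (intro sym_rtrancl sym_Un_converse)
qed (auto simp: refl_on_def trans_rtrancl)

text \<open>Hasse edges are pairs of \<open>r\<close>, so \<open>f\<close> is constant along paths.
  Applied to membership predicates, this confines a component to the field or to a block.\<close>

lemma components_invariant:
  assumes "\<And>x y. (x, y) \<in> r \<Longrightarrow> f x = f y" "D \<in> components r" "x \<in> D" "y \<in> D"
  shows "f x = f y"
proof -
  have *: "f a = f b" if "(a, b) \<in> (hasse_diagram r \<union> (hasse_diagram r)\<inverse>)\<^sup>*" for a b
    using that
  proof induction
    case (step b c)
    then have "(b, c) \<in> r \<or> (c, b) \<in> r" by (auto simp: hasse_diagram_def)
    then show ?case using step assms(1) by metis
  qed simp
  from assms obtain a where "D = (hasse_diagram r \<union> (hasse_diagram r)\<inverse>)\<^sup>* `` {a}"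
    by (auto simp: components_def elim: quotientE)
  then show ?thesis using * assms by (metis Image_singleton_iff)
qed

lemma components_quotient:
  "components r \<subseteq> UNIV // (hasse_diagram r \<union> (hasse_diagram r)\<inverse>)\<^sup>*"
  unfolding components_def quotient_def by blast

lemma components_disjoint:
  assumes "D \<in> components r" "E \<in> components r"
  shows "D = E \<or> D \<inter> E = {}"
  using assms components_quotient by (intro quotient_disj[OF equiv_hasse[of r]]) blast+

lemma components_nonempty:
  assumes "D \<in> components r"
  shows "D \<noteq> {}"
  using assms components_quotient in_quotient_imp_non_empty[OF equiv_hasse[of r]] by blast

lemma components_subset:
  assumes "D \<in> components r"
  shows "D \<subseteq> Field r"
proof -
  from assms obtain a where a: "a \<in> Field r" "D = (hasse_diagram r \<union> (hasse_diagram r)\<inverse>)\<^sup>* `` {a}"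
    by (auto simp: components_def elim: quotientE)
  have "(x \<in> Field r) = (y \<in> Field r)" if "(x, y) \<in> r" for x y
    using that by (auto simp: Field_def)
  moreover have "a \<in> D" using a by simp
  ultimately show ?thesis
    using components_invariant[of r "\<lambda>x. x \<in> Field r" D a] a assms by blast
qed

lemma Union_components: "\<Union>(components r) = Field r"
proof
  show "\<Union>(components r) \<subseteq> Field r" using components_subset by auto
  show "Field r \<subseteq> \<Union>(components r)"
    by (auto simp: components_def quotient_def)
qed

text \<open>Finiteness enters here: comparable points are joined by a path of covers, so they lie in
  the same component.\<close>

lemma components_closed:
  assumes "finite (Field r)" "refl_on (Field r) r" "trans r" "antisym r"
    and "(x, y) \<in> r" "D \<in> components r"
  shows "x \<in> D \<longleftrightarrow> y \<in> D"
proof -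
  let ?h = "(hasse_diagram r \<union> (hasse_diagram r)\<inverse>)\<^sup>*"
  have "(x, y) \<in> ?h"
    using finite_order_hasse[OF assms(1-5)] by (rule rtrancl_mono[THEN subsetD, rotated]) simp
  moreover from this have "(y, x) \<in> ?h"
    using equiv_hasse[of r] by (auto simp: equiv_def dest: symD)
  moreover obtain a where "D = ?h `` {a}"
    using assms(6) by (auto simp: components_def elim: quotientE)
  ultimately show ?thesis by (auto intro: rtrancl_trans)
qed


subsection \<open>The compositions with a given fracturing\<close>

text \<open>The test on \<open>D\<close> tells components from singletons off \<open>Q\<close>. Both
  cases refer only to points of \<open>Q\<close>, so no point outside \<open>Q\<close> constrains
  another chunk.\<close>

definition chunk_condition :: "'a rel \<Rightarrow> 'a rel \<Rightarrow> 'a set \<Rightarrow> 'a set \<Rightarrow> bool" where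
  "chunk_condition P Q D X \<longleftrightarrow>
     (if D \<subseteq> Field Q then P `` D \<inter> Field Q - D \<subseteq> X else P\<inverse> `` D \<inter> Field Q \<inter> X \<noteq> {})"

definition chunks_of :: "'a set \<Rightarrow> 'a rel \<Rightarrow> 'a set set" where
  "chunks_of I Q = components Q \<union> (\<lambda>x. {x}) ` (I - Field Q)"

context
  fixes I :: "'a set" and P Q :: "'a rel" and \<Phi>\<^sub>0 :: "'a set list"
  assumes fin: "finite I" and P: "partial_order_on I P"
    and \<Phi>\<^sub>0: "\<Phi>\<^sub>0 \<in> set_compositions I" and Q: "Q = fracture P \<Phi>\<^sub>0"
begin

lemma P_trans: "(x, y) \<in> P \<Longrightarrow> (y, z) \<in> P \<Longrightarrow> (x, z) \<in> P"
  using P by (auto simp: partial_order_on_def preorder_on_def trans_def)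

lemma P_in: "(x, y) \<in> P \<Longrightarrow> x \<in> I \<and> y \<in> I"
  using P by (auto simp: partial_order_on_def preorder_on_def refl_on_def)

lemma Field_Q: "Field Q = I \<inter> unpreceded P \<Phi>\<^sub>0"
  using Field_fracture[OF P \<Phi>\<^sub>0] Q by simp

lemma Field_Q_subset: "Field Q \<subseteq> I"
  using Field_Q by simp

lemma Q_closed:
  assumes "(x, y) \<in> Q" "D \<in> components Q"
  shows "x \<in> D \<longleftrightarrow> y \<in> D"
proof -
  have "fracturing P Q" using fracturing_fracture[OF P \<Phi>\<^sub>0] Q by simp
  then show ?thesis
    using assms finite_subset[OF Field_Q_subset fin]
    by (intro components_closed fracturing_partial_order[OF P])
qed

lemma Union_chunks_of: "\<Union>(chunks_of I Q) = I"
  using Union_components[of Q] Field_Q_subset by (auto simp: chunks_of_def)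

text \<open>Points related in \<open>Q\<close> share a block, so membership in a fixed block is
  constant on a component.\<close>

lemma component_block:
  assumes "\<Phi> \<in> set_compositions I" "fracture P \<Phi> = Q" "D \<in> components Q"
  shows "\<exists>B\<in>set \<Phi>. D \<subseteq> B"
proof -
  have \<Phi>: "comp_list \<Phi>" "\<Union>(set \<Phi>) = I" using assms by (auto simp: set_compositions_iff)
  obtain d where d: "d \<in> D" using components_nonempty assms by blast
  then obtain B where B: "B \<in> set \<Phi>" "d \<in> B"
    using components_subset[OF assms(3)] Field_Q_subset \<Phi> by auto
  have "(x \<in> B) = (y \<in> B)" if "(x, y) \<in> Q" for x y
    using that comp_list_same_block[OF \<Phi>(1)] B by (auto simp: assms(2)[symmetric] fracture_def)
  then show ?thesis
    using components_invariant[of Q "\<lambda>x. x \<in> B" D d] assms(3) d B by blast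
qed

lemma component_induced:
  assumes "D \<in> components Q" "x \<in> D" "y \<in> D" "(x, y) \<in> P"
  shows "(x, y) \<in> Q"
proof -
  obtain B where "B \<in> set \<Phi>\<^sub>0" "D \<subseteq> B"
    using component_block[OF \<Phi>\<^sub>0 Q[symmetric] assms(1)] by auto
  moreover have "y \<in> unpreceded P \<Phi>\<^sub>0"
    using assms components_subset Field_Q by blast
  ultimately show ?thesis
    using assms by (auto simp: Q fracture_def)
qed

text \<open>Descent: a preceded \<open>z\<close> is replaced by a point below and before it. Its
  preceding set shrinks strictly, so the descent ends at an unpreceded point, still below
  \<open>x\<close> and before it by transitivity.\<close>

lemma ex_unpreceded_below:
  assumes "comp_list \<Phi>" "\<Union>(set \<Phi>) = I" "x \<in> I" "x \<notin> unpreceded P \<Phi>"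
  shows "\<exists>y. (y, x) \<in> P \<and> y \<in> preceding \<Phi> x \<and> y \<in> unpreceded P \<Phi>"
proof -
  have "\<exists>y. (y, x) \<in> P \<and> y \<in> preceding \<Phi> x \<and> y \<in> unpreceded P \<Phi>"
    if "(z, x) \<in> P" "z \<in> preceding \<Phi> x" for z
    using that
  proof (induction "card (preceding \<Phi> z)" arbitrary: z rule: less_induct)
    case less
    show ?case
    proof (cases "z \<in> unpreceded P \<Phi>")
      case False
      then obtain w where w: "(w, z) \<in> P" "w \<in> preceding \<Phi> z" by (auto simp: unpreceded_def)
      have "finite (preceding \<Phi> z)"
        using fin preceding_subset[of \<Phi> z] assms finite_subset by metis
      then have "card (preceding \<Phi> w) < card (preceding \<Phi> z)"
        using preceding_psubset[OF w(2) assms(1)] by (rule psubset_card_mono)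
      then show ?thesis
        using less w P_trans preceding_trans assms(1) by meson
    qed (use less in auto)
  qed
  then show ?thesis using assms(4) by (auto simp: unpreceded_def)
qed

text \<open>Let \<open>y\<close> in \<open>Q\<close>, outside \<open>D\<close>, lie above
  \<open>w\<close> in \<open>D\<close>. Then \<open>w\<close> does not precede \<open>y\<close>,
  which is unpreceded, and a common block would relate them in \<open>Q\<close> and put
  \<open>y\<close> into \<open>D\<close>. Only \<open>y\<close> before \<open>w\<close>
  remains.\<close>

lemma component_condition:
  assumes "\<Phi> \<in> set_compositions I" "fracture P \<Phi> = Q" "D \<in> components Q" "x \<in> D"
  shows "P `` D \<inter> Field Q - D \<subseteq> preceding \<Phi> x"
proof
  have \<Phi>: "comp_list \<Phi>" "\<Union>(set \<Phi>) = I" using assms by (auto simp: set_compositions_iff)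
  fix y assume "y \<in> P `` D \<inter> Field Q - D"
  then obtain w where w: "w \<in> D" "(w, y) \<in> P" "y \<in> Field Q" "y \<notin> D" by auto
  have un: "y \<in> unpreceded P \<Phi>"
    using w Field_fracture[OF P assms(1)] assms(2) by auto
  then have "w \<notin> preceding \<Phi> y" using w by (auto simp: unpreceded_def)
  moreover have "\<not> (\<exists>B\<in>set \<Phi>. w \<in> B \<and> y \<in> B)"
  proof
    assume "\<exists>B\<in>set \<Phi>. w \<in> B \<and> y \<in> B"
    then have "(w, y) \<in> Q" using un w by (auto simp: assms(2)[symmetric] fracture_def)
    then show False using Q_closed assms(3) w by blast
  qed
  ultimately have "y \<in> preceding \<Phi> w"
    using preceding_total[of w \<Phi> y] w P_in \<Phi> by blast
  moreover obtain B where "B \<in> set \<Phi>" "D \<subseteq> B"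
    using component_block assms by blast
  then have "preceding \<Phi> w = preceding \<Phi> x"
    using preceding_same_block[OF \<Phi>(1)] w assms(4) by blast
  ultimately show "y \<in> preceding \<Phi> x" by simp
qed

lemma fracture_imp_chunk_compositions:
  assumes "\<Phi> \<in> set_compositions I" "fracture P \<Phi> = Q"
  shows "\<Phi> \<in> chunk_compositions (chunk_condition P Q) (chunks_of I Q)"
proof -
  have \<Phi>: "comp_list \<Phi>" "\<Union>(set \<Phi>) = I" using assms by (auto simp: set_compositions_iff)
  have "(\<exists>B\<in>set \<Phi>. D \<subseteq> B) \<and> (\<forall>x\<in>D. chunk_condition P Q D (preceding \<Phi> x))"
    if D: "D \<in> chunks_of I Q" for D
  proof (cases "D \<in> components Q")
    case True
    then show ?thesis
      using component_block[OF assms True] component_condition[OF assms True]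
        components_subset[OF True] by (simp add: chunk_condition_def)
  next
    case False
    then obtain x where x: "D = {x}" "x \<in> I" "x \<notin> Field Q" using D by (auto simp: chunks_of_def)
    then have "x \<notin> unpreceded P \<Phi>"
      using Field_fracture[OF P assms(1)] assms(2) by auto
    then obtain y where y: "(y, x) \<in> P" "y \<in> preceding \<Phi> x" "y \<in> unpreceded P \<Phi>"
      using ex_unpreceded_below \<Phi> x by blast
    then have "y \<in> Field Q"
      using Field_fracture[OF P assms(1)] assms(2) P_in by auto
    then show ?thesis
      using x y \<Phi> by (auto simp: chunk_condition_def)
  qed
  then show ?thesis
    using assms by (simp add: chunk_compositions_def Union_chunks_of)
qed

text \<open>The main point is that the unpreceded points of \<open>I\<close> are again exactly those
  of \<open>Q\<close>. A point off \<open>Q\<close> is preceded by its condition. If some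
  \<open>z\<close> off \<open>Q\<close> preceded a point of \<open>Q\<close> above it, the condition
  on \<open>z\<close> would yield a point of \<open>Q\<close> doing the same, which the component
  conditions exclude.\<close>

lemma chunk_compositions_imp_fracture:
  assumes "\<Phi> \<in> chunk_compositions (chunk_condition P Q) (chunks_of I Q)"
  shows "\<Phi> \<in> set_compositions I \<and> fracture P \<Phi> = Q"
proof -
  have comp: "\<Phi> \<in> set_compositions I"
    using assms by (simp add: chunk_compositions_def Union_chunks_of)
  then have \<Phi>: "comp_list \<Phi>" "\<Union>(set \<Phi>) = I" by (auto simp: set_compositions_iff)
  have comps: "(\<exists>B\<in>set \<Phi>. D \<subseteq> B) \<and> (\<forall>x\<in>D. P `` D \<inter> Field Q - D \<subseteq> preceding \<Phi> x)"
    if "D \<in> components Q" for D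
    using assms that components_subset[OF that]
    by (auto simp: chunk_compositions_def chunks_of_def chunk_condition_def)
  have single: "\<exists>y. (y, x) \<in> P \<and> y \<in> Field Q \<and> y \<in> preceding \<Phi> x" if "x \<in> I" "x \<notin> Field Q" for x
  proof -
    have "{x} \<in> chunks_of I Q" using that by (simp add: chunks_of_def)
    then have "chunk_condition P Q {x} (preceding \<Phi> x)"
      using assms by (auto simp: chunk_compositions_def)
    then show ?thesis using that by (auto simp: chunk_condition_def)
  qed
  have ex_comp: "\<exists>D\<in>components Q. x \<in> D" if "x \<in> Field Q" for x
    using that Union_components[of Q] by blast
  \<comment> \<open>Comparable points of \<open>Q\<close> either share a component, hence a block,
    or the upper one is forced to come first.\<close>
  have apart: "y \<in> preceding \<Phi> x \<or> (x, y) \<in> Q \<and> (\<exists>B\<in>set \<Phi>. x \<in> B \<and> y \<in> B)"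
    if xy: "x \<in> Field Q" "y \<in> Field Q" "(x, y) \<in> P" for x y
  proof -
    obtain D where D: "D \<in> components Q" "x \<in> D" using ex_comp[OF xy(1)] by blast
    show ?thesis
    proof (cases "y \<in> D")
      case True
      then show ?thesis using comps[OF D(1)] D component_induced xy(3) by blast
    next
      case False
      then show ?thesis using comps[OF D(1)] D xy by blast
    qed
  qed
  have below: "z \<notin> preceding \<Phi> x" if "x \<in> Field Q" "z \<in> Field Q" "(z, x) \<in> P" for x z
  proof
    assume z: "z \<in> preceding \<Phi> x"
    then have "x \<notin> preceding \<Phi> z"
      using preceding_trans preceding_irrefl \<Phi> by metis
    then show False
      using apart[OF that(2,1,3)] not_preceding_same_block[OF \<Phi>(1)] z by blast
  qed
  have unp: "x \<in> unpreceded P \<Phi>" if x: "x \<in> Field Q" for x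
    unfolding unpreceded_def
  proof (intro CollectI allI impI notI)
    fix z assume z: "(z, x) \<in> P" "z \<in> preceding \<Phi> x"
    then have "z \<notin> Field Q" using below x by blast
    then obtain y where "(y, z) \<in> P" "y \<in> Field Q" "y \<in> preceding \<Phi> z"
      using single z P_in by blast
    then show False
      using below[OF x, of y] z P_trans preceding_trans \<Phi>(1) by metis
  qed
  have "fracture P \<Phi> = Q"
  proof (intro equalityI subsetI; clarify)
    fix x y assume xy: "(x, y) \<in> fracture P \<Phi>"
    then obtain B where B: "B \<in> set \<Phi>" "x \<in> B" "y \<in> B" "(x, y) \<in> P" by (auto simp: fracture_def)
    have "x \<in> Field (fracture P \<Phi>)" "y \<in> Field (fracture P \<Phi>)"
      using xy by (auto simp: Field_def)
    then have "x \<in> Field Q \<and> y \<in> Field Q"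
      using Field_fracture[OF P comp] single unfolding unpreceded_def by blast
    then show "(x, y) \<in> Q"
      using apart B not_preceding_same_block[OF \<Phi>(1)] by blast
  next
    fix x y assume xy: "(x, y) \<in> Q"
    then have F: "x \<in> Field Q" "y \<in> Field Q" "(x, y) \<in> P" by (auto simp: Field_def Q fracture_def)
    obtain D where D: "D \<in> components Q" "x \<in> D" using ex_comp F by blast
    then have "y \<in> D" using Q_closed xy by blast
    then show "(x, y) \<in> fracture P \<Phi>"
      using F unp comps[OF D(1)] D by (auto simp: fracture_def)
  qed
  then show ?thesis using comp by simp
qed

text \<open>
  Inserting the components in the order in which \<open>\<Phi>\<^sub>0\<close> lists them makes every component come after
  those that it is required to follow.
\<close>

lemma chunks_components:
  assumes "finite K" "K \<subseteq> components Q" "\<And>D. D \<in> K \<Longrightarrow> P `` D \<inter> Field Q - D \<subseteq> \<Union>K"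
  shows "chunks (chunk_condition P Q) K"
  using assms
\<comment> \<open>The rank of a component counts the points that \<open>\<Phi>\<^sub>0\<close> lists
  before its block; the inserted \<open>D\<close> has maximal rank.\<close>
proof (induction rule: finite_ranking_induct[where f = "\<lambda>D. card (\<Union>x\<in>D. preceding \<Phi>\<^sub>0 x)"])
  case empty
  show ?case by (rule chunks.empty)
next
  case (insert D K)
  show ?case
  proof (cases "D \<in> K")
    case True
    then show ?thesis using insert by (simp add: insert_absorb)
  next
    case False
    have \<Phi>0: "comp_list \<Phi>\<^sub>0" "\<Union>(set \<Phi>\<^sub>0) = I" using \<Phi>\<^sub>0 by (auto simp: set_compositions_iff)
    have prec: "(\<Union>x\<in>E. preceding \<Phi>\<^sub>0 x) = preceding \<Phi>\<^sub>0 x" if "E \<in> components Q" "x \<in> E" for E x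
    proof -
      obtain B where "B \<in> set \<Phi>\<^sub>0" "E \<subseteq> B"
        using component_block[OF \<Phi>\<^sub>0 Q[symmetric]] \<open>E \<in> components Q\<close> by blast
      then have "preceding \<Phi>\<^sub>0 w = preceding \<Phi>\<^sub>0 x" if "w \<in> E" for w
        using preceding_same_block[OF \<Phi>0(1)] \<open>x \<in> E\<close> that by blast
      then show ?thesis using \<open>x \<in> E\<close> by blast
    qed
    have dis: "D \<inter> \<Union>K = {}"
      using insert.prems(1) False components_disjoint[of D Q] by blast
    \<comment> \<open>The closure premise survives the removal of \<open>D\<close>: if some
      \<open>E\<close> in \<open>K\<close> had to follow \<open>D\<close>, then
      \<open>\<Phi>\<^sub>0\<close> would list \<open>D\<close> strictly before \<open>E\<close>,
      against maximality of the rank of \<open>D\<close>.\<close>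
    have later: "(P `` E \<inter> Field Q - E) \<inter> D = {}" if "E \<in> K" for E
    proof (rule ccontr)
      assume "(P `` E \<inter> Field Q - E) \<inter> D \<noteq> {}"
      then obtain y where y: "y \<in> P `` E \<inter> Field Q - E" "y \<in> D" by blast
      then obtain x where x: "x \<in> E" by blast
      have E: "E \<in> components Q" "D \<in> components Q" using insert.prems that by auto
      have "y \<in> preceding \<Phi>\<^sub>0 x"
        using component_condition[OF \<Phi>\<^sub>0 Q[symmetric] E(1) x] y by blast
      then have "preceding \<Phi>\<^sub>0 y \<subset> preceding \<Phi>\<^sub>0 x"
        using preceding_psubset \<Phi>0 by metis
      moreover have "finite (preceding \<Phi>\<^sub>0 x)"
        using fin preceding_subset[of \<Phi>\<^sub>0 x] \<Phi>0 finite_subset by metis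
      ultimately have "card (preceding \<Phi>\<^sub>0 y) < card (preceding \<Phi>\<^sub>0 x)"
        by (simp add: psubset_card_mono)
      then show False
        using insert.hyps(2)[OF that] prec[OF E(1) x] prec[OF E(2) y(2)] by simp
    qed
    have "P `` E \<inter> Field Q - E \<subseteq> \<Union>K" if "E \<in> K" for E
      using insert.prems(2)[of E] later[OF that] that by blast
    then have IH: "chunks (chunk_condition P Q) K"
      using insert by auto
    have "D \<in> components Q" using insert.prems(1) by simp
    then have D: "D \<subseteq> Field Q" "D \<noteq> {}"
      by (rule components_subset, rule components_nonempty)
    have sub: "P `` D \<inter> Field Q - D \<subseteq> \<Union>K"
      using insert.prems(2)[of D] by blast
    show ?thesis
      using IH D(2) dis
    proof (rule chunks.insert)
      show "mono (chunk_condition P Q D)"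
        using D(1) by (auto simp: mono_def chunk_condition_def)
      show "chunk_condition P Q D X \<longleftrightarrow> chunk_condition P Q D (X \<inter> \<Union>K)" for X
        using D(1) sub by (auto simp: chunk_condition_def)
      show "chunk_condition P Q D (\<Union>K)"
        using D(1) sub by (simp add: chunk_condition_def)
    qed
  qed
qed

lemma finite_components: "finite (components Q)"
  using fin Field_Q_subset by (auto simp: components_def quotient_def intro: finite_subset)

text \<open>The components come first. The remaining points follow in any order, each depending only
  on points of \<open>Q\<close>; the composition \<open>\<Phi>\<^sub>0\<close> supplies a point of
  \<open>Q\<close> below each of them.\<close>

lemma chunks_chunks_of: "chunks (chunk_condition P Q) (chunks_of I Q)"
proof -
  have "chunks (chunk_condition P Q) (components Q \<union> (\<lambda>x. {x}) ` X)"
    if "finite X" "X \<subseteq> I - Field Q" for X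
    using that
  proof induction
    case empty
    show ?case
      using chunks_components[OF finite_components] Union_components[of Q] by auto
  next
    case (insert x X)
    let ?K = "components Q \<union> (\<lambda>x. {x}) ` X"
    have U: "\<Union>?K = Field Q \<union> X" using Union_components[of Q] by auto
    have x: "x \<in> I" "x \<notin> Field Q" "\<not> {x} \<subseteq> Field Q" using insert.prems by auto
    have \<Phi>0: "comp_list \<Phi>\<^sub>0" "\<Union>(set \<Phi>\<^sub>0) = I" using \<Phi>\<^sub>0 by (auto simp: set_compositions_iff)
    have "x \<notin> unpreceded P \<Phi>\<^sub>0" using x Field_Q by blast
    then obtain y where y: "(y, x) \<in> P" "y \<in> Field Q"
      using ex_unpreceded_below[OF \<Phi>0 x(1)] Field_Q P_in by blast
    have "chunks (chunk_condition P Q) (insert {x} ?K)"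
    proof (rule chunks.insert)
      show "chunks (chunk_condition P Q) ?K" using insert by auto
      show "{x} \<inter> \<Union>?K = {}" unfolding U using insert by auto
      show "mono (chunk_condition P Q {x})"
        using x by (auto simp: mono_def chunk_condition_def)
      show "chunk_condition P Q {x} X \<longleftrightarrow> chunk_condition P Q {x} (X \<inter> \<Union>?K)" for X
        unfolding U using x by (auto simp: chunk_condition_def)
      show "chunk_condition P Q {x} (\<Union>?K)"
        unfolding U using x y by (auto simp: chunk_condition_def)
    qed simp
    then show ?case by simp
  qed
  then show ?thesis using fin by (simp add: chunks_of_def)
qed

lemma card_chunks_of: "card (chunks_of I Q) = card (components Q) + card (I - Field Q)"
proof -
  have "components Q \<inter> (\<lambda>x. {x}) ` (I - Field Q) = {}"
    using components_subset by auto
  then show ?thesis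
    unfolding chunks_of_def using fin finite_components
    by (simp add: card_Un_disjoint card_image)
qed

lemma sum_fracture_eq:
  "(\<Sum>\<Phi> | \<Phi> \<in> set_compositions I \<and> fracture P \<Phi> = Q. (-1) ^ length \<Phi>) =
     ((-1) ^ (card (components Q) + card (I - Field Q)) :: 'k::comm_ring_1)"
proof -
  have "{\<Phi>. \<Phi> \<in> set_compositions I \<and> fracture P \<Phi> = Q} =
      chunk_compositions (chunk_condition P Q) (chunks_of I Q)"
    using fracture_imp_chunk_compositions chunk_compositions_imp_fracture by blast
  then show ?thesis
    using sum_chunk_compositions[OF chunks_chunks_of] fin
    by (simp add: Union_chunks_of card_chunks_of)
qed

end

section \<open>The antipode formula\<close>

lemma sum_single: "(\<Sum>x\<in>A. Poly_Mapping.single k (f x)) = Poly_Mapping.single k (\<Sum>x\<in>A. f x)"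
  by (induction A rule: infinite_finite_induct) (simp_all add: single_add)

theorem theorem4p15:
  fixes P :: "'a rel" and I :: "'a set"
  assumes "finite I" and "partial_order_on I P"
  shows "antipode (Poly_Mapping.single (order_ideals P, I) (1::'k::field)) =
           (\<Sum>Q\<in>Good P. Poly_Mapping.single (order_ideals Q, I)
                          ((-1) ^ (card (components Q) + card (I - Field Q))))
         \<and> inj_on (\<lambda>Q. (order_ideals Q, I)) (Good P)"
proof
  let ?S = "set_compositions I"
  have "antipode (Poly_Mapping.single (order_ideals P, I) (1::'k)) =
      (\<Sum>\<Phi>\<in>?S. Poly_Mapping.single (order_ideals (fracture P \<Phi>), I) ((-1) ^ length \<Phi>))"
    unfolding antipode_single antipode_basis_def snd_conv
    by (intro sum.cong refl) (simp add: mu_Delta_order_ideals[OF assms(2)])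
  \<comment> \<open>The compositions are grouped by their fracturing. As \<open>Good P\<close> is
    the image, every group contains a composition that can serve as
    \<open>\<Phi>\<^sub>0\<close>.\<close>
  also have "\<dots> = (\<Sum>Q\<in>Good P. \<Sum>\<Phi> | \<Phi> \<in> ?S \<and> fracture P \<Phi> = Q.
      Poly_Mapping.single (order_ideals (fracture P \<Phi>), I) ((-1) ^ length \<Phi>))"
    unfolding Good_eq[OF assms(2)] using finite_set_compositions[OF assms(1)] by (rule sum.image_gen)
  also have "\<dots> = (\<Sum>Q\<in>Good P. Poly_Mapping.single (order_ideals Q, I)
      ((-1) ^ (card (components Q) + card (I - Field Q))))"
  proof (intro sum.cong refl)
    fix Q assume "Q \<in> Good P"
    then obtain \<Phi>\<^sub>0 where \<Phi>\<^sub>0: "\<Phi>\<^sub>0 \<in> ?S" "Q = fracture P \<Phi>\<^sub>0"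
      using Good_eq[OF assms(2)] by auto
    have "(\<Sum>\<Phi> | \<Phi> \<in> ?S \<and> fracture P \<Phi> = Q.
        Poly_Mapping.single (order_ideals (fracture P \<Phi>), I) ((-1) ^ length \<Phi> :: 'k)) =
      (\<Sum>\<Phi> | \<Phi> \<in> ?S \<and> fracture P \<Phi> = Q. Poly_Mapping.single (order_ideals Q, I) ((-1) ^ length \<Phi>))"
      by (intro sum.cong) auto
    then show "(\<Sum>\<Phi> | \<Phi> \<in> ?S \<and> fracture P \<Phi> = Q.
        Poly_Mapping.single (order_ideals (fracture P \<Phi>), I) ((-1) ^ length \<Phi> :: 'k)) =
      Poly_Mapping.single (order_ideals Q, I) ((-1) ^ (card (components Q) + card (I - Field Q)))"
      by (simp add: sum_single sum_fracture_eq[OF assms \<Phi>\<^sub>0])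
  qed
  finally show "antipode (Poly_Mapping.single (order_ideals P, I) (1::'k)) =
      (\<Sum>Q\<in>Good P. Poly_Mapping.single (order_ideals Q, I)
        ((-1) ^ (card (components Q) + card (I - Field Q))))" .
  show "inj_on (\<lambda>Q. (order_ideals Q, I)) (Good P)"
    using inj_on_order_ideals_Good[OF assms(2)] by (auto simp: inj_on_def)
qed

end
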